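(* Let $X$ be a compact metric space, $\mu$ a Borel probability measure on $X$, $Y$ a metric space, and $f:X\to Y$ a function. Consider the following properties: 1) $f$ is $\mu$-Lusin. 2) $f$ is $\mu$-continuous. If $(X,\mu)$ is Vitali, then 2) implies 1). If $(X,\mu)$ satisfies Lebesgue's density theorem, then 1) implies 2).
   Context: $\mathbb{N}=\{1,2,\dots\}$. Let $d$ be the metric of $X$ and $d_Y$ the metric of $Y$; put $B_n(x)=\{z\in X: d(x,z)\le 1/n\}$ and $B^Y_m(y)=\{z\in Y: d_Y(y,z)\le 1/m\}$. A set $A \subset X$ is $\mu$-measurable if it belongs to the completion of the Borel $\sigma$-algebra with respect to $\mu$; similarly $\mu\times\mu$-measurable on $X\times X$ refers to the completion with respect to $\mu\times\mu$. $f:X\to Y$ is $\mu$-Lusin if for every $\varepsilon>0$ there exists a compact set $M\subset X$ such that $\mu(M)>1-\varepsilon$ and $f|_M$ is continuous. A point $x\in X$ is a $\mu$-continuity point of $f$ if for every $m\in\mathbb{N}$ the function $1_{f^{-1}(B^Y_m(f(x)))}$ is $\mu\times\mu$-measurable, meaning that the function $(x',z)\mapsto 1_{f^{-1}(B^Y_m(f(x')))}(z)$ on $X\times X$ is $\mu\times\mu$-measurable, and $$\lim_{n\to\infty}\frac{\mu\left[f^{-1}(B^Y_m(f(x)))\cap B_n(x)\right]}{\mu(B_n(x))}=1$$ (it is implicit in this formula that $f^{-1}(B^Y_m(f(x)))$ is $\mu$-measurable and that $\mu(B_n(x))>0$ for all $n$). The function $f$ is $\mu$-continuous if $\mu$-almost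 every $x\in X$ is a $\mu$-continuity point of $f$. $(X,\mu)$ satisfies Lebesgue's density theorem if for every Borel set $A\subset X$, $\lim_{n\to\infty}\frac{\mu(A\cap B_n(x))}{\mu(B_n(x))}=1$ for $\mu$-a.e. $x\in A$. $(X,\mu)$ is Vitali if for every Borel set $A\subset X$, every $N\in\mathbb{N}$ and every $\varepsilon>0$, there exist a finite subset $F\subset A$ and integers $n_x\ge N$ (for $x\in F$) such that the balls $\{B_{n_x}(x)\}_{x\in F}$ are pairwise disjoint and $\mu(A\setminus\bigcup_{x\in F}B_{n_x}(x))\le\varepsilon$. *)

theory Defs
  imports "HOL-Probability.Probability"
begin

text \<open>
  The compact metric space is the whole type \<open>'a\<close>, and the measures below are meant to be
  Borel probability measures on it. Since the positive integers are the index set of the balls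
  \<open>cball x (1 / n)\<close>, the index 0 is excluded explicitly wherever it would matter.
\<close>

definition mu_Lusin :: "'a::metric_space measure \<Rightarrow> ('a \<Rightarrow> 'b::metric_space) \<Rightarrow> bool" where
  "mu_Lusin \<mu> f \<longleftrightarrow>
    (\<forall>\<epsilon>>0. \<exists>M. compact M \<and> measure \<mu> M > 1 - \<epsilon> \<and> continuous_on M f)"

text \<open>
  The preimages of balls need not be Borel, so both measurability and measure are taken in the
  completion. The product measurability condition does not depend on the point \<open>x\<close>.
\<close>

definition mu_continuity_point ::
  "'a::metric_space measure \<Rightarrow> ('a \<Rightarrow> 'b::metric_space) \<Rightarrow> 'a \<Rightarrow> bool" where
  "mu_continuity_point \<mu> f x \<longleftrightarrow>
    (\<forall>n\<ge>1. measure \<mu> (cball x (1 / real n)) > 0) \<and>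
    (\<forall>m\<ge>1.
      (\<lambda>(x', z). indicator (f -` cball (f x') (1 / real m)) z :: real)
        \<in> borel_measurable (completion (\<mu> \<Otimes>\<^sub>M \<mu>)) \<and>
      f -` cball (f x) (1 / real m) \<in> sets (completion \<mu>) \<and>
      (\<lambda>n. measure (completion \<mu>) (f -` cball (f x) (1 / real m) \<inter> cball x (1 / real n))
             / measure \<mu> (cball x (1 / real n))) \<longlonglongrightarrow> 1)"

definition mu_continuous :: "'a::metric_space measure \<Rightarrow> ('a \<Rightarrow> 'b::metric_space) \<Rightarrow> bool" where
  "mu_continuous \<mu> f \<longleftrightarrow> (AE x in \<mu>. mu_continuity_point \<mu> f x)"

text \<open>
  As \<open>r / 0 = 0\<close>, a limit of 1 below already forces all balls around \<open>x\<close> to have positive measure.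
\<close>

definition satisfies_Lebesgue_density :: "'a::metric_space measure \<Rightarrow> bool" where
  "satisfies_Lebesgue_density \<mu> \<longleftrightarrow>
    (\<forall>A \<in> sets borel. AE x in \<mu>. x \<in> A \<longrightarrow>
      (\<lambda>n. measure \<mu> (A \<inter> cball x (1 / real n)) / measure \<mu> (cball x (1 / real n)))
        \<longlonglongrightarrow> 1)"

definition is_Vitali :: "'a::metric_space measure \<Rightarrow> bool" where
  "is_Vitali \<mu> \<longleftrightarrow>
    (\<forall>A \<in> sets borel. \<forall>N\<ge>1. \<forall>\<epsilon>>0. \<exists>F (k :: 'a \<Rightarrow> nat).
      finite F \<and> F \<subseteq> A \<and> (\<forall>x\<in>F. k x \<ge> N) \<and>
      disjoint_family_on (\<lambda>x. cball x (1 / real (k x))) F \<and>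
      measure \<mu> (A - (\<Union>x\<in>F. cball x (1 / real (k x)))) \<le> \<epsilon>)"

end

theory Submission
  imports Defs
begin

text \<open>
  From 2) to 1): by Fubini, the preimages of the balls of radius \<open>1 / m\<close> can be replaced by Borel
  sections of one Borel subset of the square, so the points \<open>x\<close> at which the preimage of the ball around
  \<open>f x\<close> fills most of \<open>cball x (1 / n)\<close> for all \<open>n \<ge> k\<close> form a Borel set, whose measure tends to 1 as
  \<open>k\<close> grows. The Vitali property yields finitely many disjoint closed pieces of almost full
  measure on each of which \<open>f\<close> oscillates little. Disjoint closed pieces are separated, so
  intersecting over all \<open>m\<close> gives a compact set on which \<open>f\<close> is continuous.

  From 1) to 2): almost every point is a density point of some compact set on which \<open>f\<close> is continuous,
  and near such a point that set lies in the preimage of any given ball around \<open>f x\<close>.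
\<close>

section \<open>Borel structure: closed subsets of a product, inner regularity\<close>

text \<open>
  The library equates the Borel sets of a product with the product sigma-algebra only for second
  countable type classes; here countability comes from finite nets.
\<close>

lemma closed_in_sets_borel_pair:
  fixes K :: "('a::metric_space \<times> 'b::metric_space) set"
  assumes cA: "compact (UNIV :: 'a set)" and cB: "compact (UNIV :: 'b set)" and K: "closed K"
  shows "K \<in> sets (borel \<Otimes>\<^sub>M borel)"
proof -
  have "\<exists>F. finite F \<and> (UNIV :: 'a set) \<subseteq> (\<Union>a\<in>F. ball a (inverse (Suc n)))" for n
    using cA unfolding compact_eq_totally_bounded by (metis inverse_Suc)
  then obtain F where F: "\<And>n. finite (F n)" "\<And>n. (UNIV :: 'a set) \<subseteq> (\<Union>a\<in>F n. ball a (inverse (Suc n)))"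
    by metis
  have "\<exists>G. finite G \<and> (UNIV :: 'b set) \<subseteq> (\<Union>a\<in>G. ball a (inverse (Suc n)))" for n
    using cB unfolding compact_eq_totally_bounded by (metis inverse_Suc)
  then obtain G where G: "\<And>n. finite (G n)" "\<And>n. (UNIV :: 'b set) \<subseteq> (\<Union>a\<in>G n. ball a (inverse (Suc n)))"
    by metis
  define R where "R n p = ball (fst p) (inverse (Suc n)) \<times> ball (snd p) (inverse (Suc n))"
    for n and p :: "'a \<times> 'b"
  define I where "I n = {p \<in> F n \<times> G n. R n p \<inter> K \<noteq> {}}" for n
  have fin: "finite (I n)" for n
    unfolding I_def using F(1) G(1) by auto
  have R: "R n p \<in> sets (borel \<Otimes>\<^sub>M borel)" for n p
    unfolding R_def by (intro pair_measureI) auto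
  \<comment> \<open>Each stage covers \<open>K\<close> by finitely many open rectangles, keeping
    only those that meet \<open>K\<close>, and the radii tend to 0. A point lying in all stages is
    therefore a limit of points of \<open>K\<close>, and each stage is a finite union of measurable
    rectangles.\<close>
  have "K = (\<Inter>n. \<Union>p\<in>I n. R n p)"
  proof (intro equalityI subsetI)
    fix q assume q: "q \<in> K"
    show "q \<in> (\<Inter>n. \<Union>p\<in>I n. R n p)"
    proof
      fix n
      obtain a where a: "a \<in> F n" "fst q \<in> ball a (inverse (Suc n))" using F(2)[of n] by blast
      obtain b where b: "b \<in> G n" "snd q \<in> ball b (inverse (Suc n))" using G(2)[of n] by blast
      have "q \<in> R n (a, b)" unfolding R_def using a b by (cases q) auto
      with q a b show "q \<in> (\<Union>p\<in>I n. R n p)" unfolding I_def by blast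
    qed
  next
    fix q assume q: "q \<in> (\<Inter>n. \<Union>p\<in>I n. R n p)"
    have "q \<in> closure K"
      unfolding closure_approachable
    proof (intro allI impI)
      fix e :: real assume "e > 0"
      \<comment> \<open>The quarter: in each coordinate \<open>q\<close> and the point
        \<open>k\<close> found below share a ball, so they are at most two radii apart, and the two
        coordinates add up.\<close>
      then obtain n where n: "inverse (Suc n) < e / 4" using reals_Archimedean[of "e/4"] by auto
      from q obtain p where p: "p \<in> I n" "q \<in> R n p" by blast
      then obtain k where k: "k \<in> K" "k \<in> R n p" unfolding I_def by blast
      have 1: "dist (fst k) (fst q) \<le> 2 * inverse (Suc n)"
        using p(2) k(2) dist_triangle3[of "fst k" "fst q" "fst p"] unfolding R_def by auto
      have 2: "dist (snd k) (snd q) \<le> 2 * inverse (Suc n)"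
        using p(2) k(2) dist_triangle3[of "snd k" "snd q" "snd p"] unfolding R_def by auto
      have "dist k q \<le> dist (fst k) (fst q) + dist (snd k) (snd q)"
        unfolding dist_prod_def using sqrt_sum_squares_le_sum_abs[of "dist (fst k) (fst q)" "dist (snd k) (snd q)"]
        by simp
      with 1 2 n have "dist k q < e" by linarith
      with k show "\<exists>y\<in>K. dist y q < e" by blast
    qed
    with K show "q \<in> K" by simp
  qed
  also have "\<dots> \<in> sets (borel \<Otimes>\<^sub>M borel)"
  proof (rule sets.countable_INT'')
    show "UNIV \<in> sets (borel \<Otimes>\<^sub>M borel :: ('a \<times> 'b) measure)"
      using sets.top[of "borel \<Otimes>\<^sub>M borel :: ('a \<times> 'b) measure"] by (simp add: space_pair_measure)
    show "(\<Union>p\<in>I n. R n p) \<in> sets (borel \<Otimes>\<^sub>M borel)" for n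
      using fin R by (intro sets.finite_UN) auto
  qed auto
  finally show ?thesis .
qed

text \<open>Borel sets that, together with their complements, can be exhausted from inside by closed
  sets form a sigma-algebra containing the open sets. This serves to turn Borel pieces into closed
  ones, since disjoint closed sets are separated.\<close>

lemma finite_borel_measure_inner_regular_closed:
  fixes M :: "'a::metric_space measure"
  assumes "finite_measure M" and sets_eq: "sets M = sets borel" and "B \<in> sets borel" and "\<epsilon> > 0"
  obtains C where "closed C" "C \<subseteq> B" "measure M (B - C) \<le> \<epsilon>"
proof -
  interpret finite_measure M by fact
  define P where "P B \<longleftrightarrow> (\<forall>e>0. \<exists>C. closed C \<and> C \<subseteq> B \<and> measure M (B - C) \<le> e)" for B :: "'a set"
  have sp: "space M = UNIV" using sets_eq_imp_space_eq[OF sets_eq] by simp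
  have [measurable]: "X \<in> sets borel \<Longrightarrow> X \<in> sets M" for X :: "'a set" by (simp add: sets_eq)
  have P_closed: "P X" if "closed X" for X
    unfolding P_def using that by (auto intro!: exI[of _ X])
  \<comment> \<open>Continuity from below: some member of the increasing sequence already carries
    almost all of the measure. Used for open sets and for countable unions.\<close>
  have limit: "P X"
    if X: "X \<in> sets borel" and C: "\<And>n::nat. closed (D n)" "X = (\<Union>n. D n)" "incseq D" for X D
  proof -
    have "(\<lambda>n. measure M (D n)) \<longlonglongrightarrow> measure M (\<Union>n. D n)"
      using C by (intro finite_Lim_measure_incseq) (auto simp: sets_eq)
    then have lim: "(\<lambda>n. measure M (D n)) \<longlonglongrightarrow> measure M X" using C by simp
    show ?thesis unfolding P_def
    proof (intro allI impI)
      fix e :: real assume "e > 0"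
      with lim have "eventually (\<lambda>n. measure M (D n) > measure M X - e) sequentially"
        by (intro order_tendstoD) auto
      then obtain n where n: "measure M (D n) > measure M X - e" 
        by (auto simp: eventually_sequentially)
      have "measure M (X - D n) = measure M X - measure M (D n)"
        using C X by (intro finite_measure_Diff) (auto simp: sets_eq)
      with n C show "\<exists>C. closed C \<and> C \<subseteq> X \<and> measure M (X - C) \<le> e"
        by (intro exI[of _ "D n"]) auto
    qed
  qed
  have "B \<in> sigma_sets UNIV {S. open S}" using \<open>B \<in> sets borel\<close> unfolding sets_borel .
  \<comment> \<open>Inner regularity alone is not preserved by complements, hence the symmetric claim.\<close>
  then have "B \<in> sets borel \<and> P B \<and> P (- B)"
  proof induction
    case (Basic U)
    then have U: "open U" by simp
    have "P U"
    \<comment> \<open>The whole space is treated apart: \<open>infdist\<close> to the empty set is 0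
      by convention, so every \<open>D n\<close> would be empty.\<close>
    proof (cases "U = UNIV")
      case False
      define D where "D n = {x. infdist x (- U) \<ge> inverse (Suc n)}" for n
      have cl: "closed (D n)" for n
        unfolding D_def by (intro closed_Collect_le continuous_intros)
      have "x \<in> (\<Union>n. D n)" if "x \<in> U" for x
      proof -
        have "infdist x (- U) \<noteq> 0"
          using in_closed_iff_infdist_zero[of "- U" x] U False that by auto
        then have "infdist x (- U) > 0" using infdist_nonneg[of x "- U"] by linarith
        then obtain n where "inverse (Suc n) < infdist x (- U)" using reals_Archimedean by blast
        then show ?thesis by (auto simp: D_def intro!: exI[of _ n])
      qed
      moreover have "x \<in> U" if "x \<in> D n" for n x
      proof -
        have "0 < inverse (real (Suc n))" by simp
        also have "\<dots> \<le> infdist x (- U)" using that by (simp add: D_def)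
        finally show ?thesis using infdist_zero[of x "- U"] by (cases "x \<in> U") auto
      qed
      ultimately have "U = (\<Union>n. D n)" by blast
      moreover have "incseq D"
        unfolding D_def incseq_def by (auto intro: order_trans[rotated] le_imp_inverse_le)
      ultimately show ?thesis using limit[of U D] cl U by auto
    qed (auto intro: P_closed)
    with U show ?case by (auto intro: P_closed)
  next
    case Empty
    show ?case by (auto intro: P_closed)
  next
    case (Compl a)
    then show ?case by (auto simp: Compl_eq_Diff_UNIV[symmetric])
  next
    case (Union a)
    have a: "a i \<in> sets borel" "P (a i)" "P (- a i)" for i using Union.IH by auto
    have "P (\<Union>i. a i)" unfolding P_def
    proof (intro allI impI)
      fix e :: real assume e: "e > 0"
      \<comment> \<open>Half of \<open>e\<close> pays, geometrically, for shrinking each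
        \<open>a i\<close> to a closed \<open>C i\<close>; the other half pays for replacing the
        union of the \<open>C i\<close>, which need not be closed, by a closed subset.\<close>
      have "\<exists>C. closed C \<and> C \<subseteq> a i \<and> measure M (a i - C) \<le> e / 2 * (1/2) ^ Suc i" for i
        by (rule a(2)[unfolded P_def, rule_format]) (use e in simp)
      then obtain C where C: "\<And>i. closed (C i)" "\<And>i. C i \<subseteq> a i"
        "\<And>i. measure M (a i - C i) \<le> e / 2 * (1/2) ^ Suc i" by metis
      have sm: "(\<lambda>i. e / 2 * (1/2) ^ Suc i) sums (e / 2 * 1)"
        by (intro sums_mult power_half_series)
      have [measurable]: "C i \<in> sets borel" "a i \<in> sets borel" for i using C a by auto
      have sm2: "summable (\<lambda>i. measure M (a i - C i))"
        using C(3) sm by (intro summable_comparison_test'[OF sums_summable[OF sm]]) auto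
      have "measure M (\<Union>i. a i - C i) \<le> (\<Sum>i. measure M (a i - C i))"
        using sm2 by (intro finite_measure_subadditive_countably) auto
      also have "\<dots> \<le> (\<Sum>i. e / 2 * (1/2) ^ Suc i)"
        using C(3) sm2 sums_summable[OF sm] by (intro suminf_le) auto
      also have "\<dots> = e / 2" using sums_unique[OF sm] by simp
      finally have 1: "measure M (\<Union>i. a i - C i) \<le> e / 2" .
      have "P (\<Union>i. C i)"
      proof (rule limit)
        show "closed (\<Union>i\<le>n. C i)" for n :: nat using C by (intro closed_UN) auto
        show "(\<Union>i. C i) = (\<Union>n. \<Union>i\<le>n. C i)" by auto
        show "incseq (\<lambda>n. \<Union>i\<le>n. C i)" by (force simp: incseq_def)
      qed measurable
      then obtain D where D: "closed D" "D \<subseteq> (\<Union>i. C i)" "measure M ((\<Union>i. C i) - D) \<le> e / 2"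
        unfolding P_def using e by (meson half_gt_zero)
      have [measurable]: "D \<in> sets borel" using D by auto
      have "measure M ((\<Union>i. a i) - D) \<le> measure M ((\<Union>i. a i - C i) \<union> ((\<Union>i. C i) - D))"
        by (intro finite_measure_mono) auto
      also have "\<dots> \<le> measure M (\<Union>i. a i - C i) + measure M ((\<Union>i. C i) - D)"
        by (intro measure_Un_le) auto
      also have "\<dots> \<le> e" using 1 D by simp
      finally have "measure M ((\<Union>i. a i) - D) \<le> e" .
      moreover have "D \<subseteq> (\<Union>i. a i)" using C(2) by (intro subset_trans[OF D(2)] UN_mono) auto
      ultimately show "\<exists>C. closed C \<and> C \<subseteq> (\<Union>i. a i) \<and> measure M ((\<Union>i. a i) - C) \<le> e"
        using D(1) by (intro exI[of _ D] conjI)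
    qed
    moreover have "P (- (\<Union>i. a i))" unfolding P_def
    proof (intro allI impI)
      fix e :: real assume e: "e > 0"
      \<comment> \<open>Here the approximating set is an intersection of closed sets, hence closed,
        so all of \<open>e\<close> can go into the geometric series.\<close>
      have "\<exists>C. closed C \<and> C \<subseteq> - a i \<and> measure M (- a i - C) \<le> e * (1/2) ^ Suc i" for i
        by (rule a(3)[unfolded P_def, rule_format]) (use e in simp)
      then obtain C where C: "\<And>i. closed (C i)" "\<And>i. C i \<subseteq> - a i"
        "\<And>i. measure M (- a i - C i) \<le> e * (1/2) ^ Suc i" by metis
      have sm: "(\<lambda>i. e * (1/2) ^ Suc i) sums (e * 1)"
        by (intro sums_mult power_half_series)
      have [measurable]: "C i \<in> sets borel" "a i \<in> sets borel" for i using C a by auto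
      have sm2: "summable (\<lambda>i. measure M (- a i - C i))"
        using C(3) sm by (intro summable_comparison_test'[OF sums_summable[OF sm]]) auto
      have "measure M (- (\<Union>i. a i) - (\<Inter>i. C i)) \<le> measure M (\<Union>i. - a i - C i)"
        by (intro finite_measure_mono) (auto simp: Compl_eq_Diff_UNIV)
      also have "\<dots> \<le> (\<Sum>i. measure M (- a i - C i))"
        using sm2 by (intro finite_measure_subadditive_countably) (auto simp: Compl_eq_Diff_UNIV)
      also have "\<dots> \<le> (\<Sum>i. e * (1/2) ^ Suc i)"
        using C(3) sm2 sums_summable[OF sm] by (intro suminf_le) auto
      also have "\<dots> = e" using sums_unique[OF sm] by simp
      finally have "measure M (- (\<Union>i. a i) - (\<Inter>i. C i)) \<le> e" .
      moreover have "(\<Inter>i. C i) \<subseteq> - (\<Union>i. a i)"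
        unfolding Compl_UN using C(2) by (intro INF_mono) auto
      moreover have "closed (\<Inter>i. C i)" using C(1) by (intro closed_INT) auto
      ultimately show "\<exists>C. closed C \<and> C \<subseteq> - (\<Union>i. a i) \<and> measure M (- (\<Union>i. a i) - C) \<le> e"
        by (intro exI[of _ "\<Inter>i. C i"] conjI)
    qed
    ultimately show ?case using a by auto
  qed
  with that \<open>\<epsilon> > 0\<close> show ?thesis unfolding P_def by blast
qed


section \<open>From mu-continuity to Lusin under the Vitali property\<close>

text \<open>The construction at a single scale \<open>m\<close>: a piece is what remains of a Vitali
  ball around \<open>x\<close> after removing the points whose value is far from \<open>f x\<close>,
  together with a set of small measure. The centre \<open>x\<close> itself may lie outside its
  piece.\<close>

lemma Vitali_continuous_pieces:
  fixes \<mu> :: "'a::metric_space measure" and f :: "'a \<Rightarrow> 'b::metric_space"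
  assumes cpt: "compact (UNIV :: 'a set)" and prob: "prob_space \<mu>" and sets_eq: "sets \<mu> = sets borel"
    and vit: "is_Vitali \<mu>" and cont: "mu_continuous \<mu> f" and m: "m \<ge> 1" and \<delta>: "\<delta> > 0"
  obtains F C where "finite F" "\<And>x. x \<in> F \<Longrightarrow> closed (C x)" "disjoint_family_on C F"
    "\<And>x z. x \<in> F \<Longrightarrow> z \<in> C x \<Longrightarrow> dist (f x) (f z) \<le> 1 / real m"
    "measure \<mu> (- (\<Union>x\<in>F. C x)) \<le> \<delta>"
proof -
  interpret prob_space \<mu> by fact
  interpret P: pair_prob_space \<mu> \<mu> by unfold_locales
  have sp: "space \<mu> = UNIV" using sets_eq_imp_space_eq[OF sets_eq] by simp
  have sp2: "space (\<mu> \<Otimes>\<^sub>M \<mu>) = UNIV" by (simp add: space_pair_measure sp)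
  have sets2: "sets (\<mu> \<Otimes>\<^sub>M \<mu>) = sets (borel \<Otimes>\<^sub>M borel)"
    using sets_eq sets_eq by (rule sets_pair_measure_cong)
  \<comment> \<open>Four losses of at most \<open>e\<close> each: points outside \<open>A k\<close>,
    points of \<open>A k\<close> missed by the Vitali balls, the bad fraction of each ball, and the
    passage to a closed set.\<close>
  define e where "e = \<delta> / 4"
  have e: "e > 0" using \<delta> by (simp add: e_def)
  define E where "E = {p. f (snd p) \<in> cball (f (fst p)) (1 / real m)}"
  have ae: "AE x in \<mu>. mu_continuity_point \<mu> f x" using cont by (simp add: mu_continuous_def)
  \<comment> \<open>Product measurability belongs to every continuity point but does not depend on
    the point, so a single one suffices; it exists because \<open>\<mu>\<close> has total mass
    1.\<close>
  have "\<exists>x. mu_continuity_point \<mu> f x"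
  proof (rule ccontr)
    assume "\<nexists>x. mu_continuity_point \<mu> f x"
    with ae have "AE x in \<mu>. False" by simp
    then show False by simp
  qed
  then have ind: "(\<lambda>(x', z). indicator (f -` cball (f x') (1 / real m)) z :: real)
        \<in> borel_measurable (completion (\<mu> \<Otimes>\<^sub>M \<mu>))"
    using m unfolding mu_continuity_point_def by blast
  have "(\<lambda>(x', z). indicator (f -` cball (f x') (1 / real m)) z :: real) -` {1}
      \<inter> space (completion (\<mu> \<Otimes>\<^sub>M \<mu>)) \<in> sets (completion (\<mu> \<Otimes>\<^sub>M \<mu>))"
    using ind by (rule measurable_sets) simp
  also have "(\<lambda>(x', z). indicator (f -` cball (f x') (1 / real m)) z :: real) -` {1}
      \<inter> space (completion (\<mu> \<Otimes>\<^sub>M \<mu>)) = E"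
    by (auto simp: E_def sp2 indicator_def split: if_splits)
  finally have E: "E \<in> sets (completion (\<mu> \<Otimes>\<^sub>M \<mu>))" .
  \<comment> \<open>\<open>E'\<close> is a subset of \<open>E\<close> in the product sigma-algebra,
    and the rest of \<open>E\<close> lies in the null set \<open>N\<close>. Hence every section of
    \<open>E'\<close> is contained in the corresponding preimage, and by Fubini almost every one
    fills it up to a null set.\<close>
  define E' where "E' = main_part (\<mu> \<Otimes>\<^sub>M \<mu>) E"
  have E'[measurable]: "E' \<in> sets (\<mu> \<Otimes>\<^sub>M \<mu>)" unfolding E'_def using E by (rule main_part_sets)
  obtain N where N: "N \<in> null_sets (\<mu> \<Otimes>\<^sub>M \<mu>)" "null_part (\<mu> \<Otimes>\<^sub>M \<mu>) E \<subseteq> N"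
    using null_part[OF E] by blast
  have E_eq: "E' \<union> null_part (\<mu> \<Otimes>\<^sub>M \<mu>) E = E"
    unfolding E'_def using E by (rule main_part_null_part_Un)
  have secE: "Pair x -` E = f -` cball (f x) (1 / real m)" for x by (auto simp: E_def)
  have sec_sub: "Pair x -` E' \<subseteq> f -` cball (f x) (1 / real m)" for x
    using E_eq secE[of x] by auto
  have sec_borel: "Pair x -` Q \<in> sets \<mu>" if "Q \<in> sets (\<mu> \<Otimes>\<^sub>M \<mu>)" for x Q
    using that by (rule sets_Pair1)
  have secN: "AE x in \<mu>. AE z in \<mu>. (x, z) \<notin> N"
    using P.AE_pair[OF AE_not_in[OF N(1)]] by simp
  \<comment> \<open>The section at \<open>x\<close> of this closed band around the diagonal is
    \<open>cball x (1 / real n)\<close>. Ball measures thus become measures of sections, which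
    depend measurably on \<open>x\<close>.\<close>
  have D: "{p. dist (fst p) (snd p) \<le> 1 / real n} \<in> sets (\<mu> \<Otimes>\<^sub>M \<mu>)" for n
    unfolding sets2 by (intro closed_in_sets_borel_pair cpt closed_Collect_le continuous_intros)
  have meas: "(\<lambda>x. measure \<mu> (Pair x -` Q)) \<in> borel_measurable \<mu>"
    if "Q \<in> sets (\<mu> \<Otimes>\<^sub>M \<mu>)" for Q
    unfolding measure_def using measurable_emeasure_Pair[OF that] by measurable
  define c where "c n x = measure \<mu> (cball x (1 / real n))" for n x
  define h where "h n x = measure \<mu> (Pair x -` E' \<inter> cball x (1 / real n))" for n x
  have [measurable]: "c n \<in> borel_measurable \<mu>" for n
  proof -
    have "c n = (\<lambda>x. measure \<mu> (Pair x -` {p. dist (fst p) (snd p) \<le> 1 / real n}))"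
      by (auto simp: c_def fun_eq_iff intro!: arg_cong[where f="measure \<mu>"])
    then show ?thesis using meas[OF D] by simp
  qed
  have [measurable]: "h n \<in> borel_measurable \<mu>" for n
  proof -
    have "h n = (\<lambda>x. measure \<mu> (Pair x -` (E' \<inter> {p. dist (fst p) (snd p) \<le> 1 / real n})))"
      by (auto simp: h_def fun_eq_iff intro!: arg_cong[where f="measure \<mu>"])
    then show ?thesis using meas[OF sets.Int[OF E' D]] by simp
  qed
  have "AE x in \<mu>. mu_continuity_point \<mu> f x \<and> (AE z in \<mu>. (x, z) \<notin> N)"
    using ae secN by eventually_elim simp
  \<comment> \<open>The exceptional set need not be Borel. Removing a Borel null set that contains
    it keeps \<open>G\<close>, and with it the sets given to the Vitali property, Borel.\<close>
  then obtain N0 where N0: "{x \<in> space \<mu>. \<not> (mu_continuity_point \<mu> f x \<and> (AE z in \<mu>. (x, z) \<notin> N))} \<subseteq> N0"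
    "emeasure \<mu> N0 = 0" "N0 \<in> sets \<mu>" by (rule AE_E)
  define G where "G = space \<mu> - N0"
  have G[measurable]: "G \<in> sets \<mu>" unfolding G_def using N0 by auto
  have mG: "measure \<mu> G = 1"
    unfolding G_def using prob_compl[OF N0(3)] N0(2) by (simp add: measure_def)
  \<comment> \<open>The bound is demanded for all \<open>n \<ge> k\<close> because the Vitali
    property controls its indices only from below. The product form avoids dividing by a vanishing
    ball measure.\<close>
  define A where "A k = {x \<in> space \<mu>. x \<in> G \<and> (\<forall>n\<in>{k..}. (1 - e) * c n x \<le> h n x)}" for k
  have A[measurable]: "A k \<in> sets \<mu>" for k unfolding A_def by measurable
  have h_eq: "measure (completion \<mu>) (f -` cball (f x) (1 / real m) \<inter> cball x (1 / real n)) = h n x"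
    if x: "x \<in> G" for n x
  proof -
    have cp: "mu_continuity_point \<mu> f x" and "AE z in \<mu>. (x, z) \<notin> N"
      using x N0(1) unfolding G_def by auto
    then have "AE z in completion \<mu>. (x, z) \<notin> N" by (intro AE_completion)
    then have 1: "AE z in completion \<mu>. z \<in> f -` cball (f x) (1 / real m) \<inter> cball x (1 / real n) \<longleftrightarrow>
        z \<in> Pair x -` E' \<inter> cball x (1 / real n)"
    proof eventually_elim
      case (elim z)
      then have "z \<in> Pair x -` E \<longleftrightarrow> z \<in> Pair x -` E'" using E_eq N(2) by auto
      then show ?case unfolding secE by auto
    qed
    have S: "f -` cball (f x) (1 / real m) \<in> sets (completion \<mu>)"
      using cp m unfolding mu_continuity_point_def by blast
    have b: "cball x (1 / real n) \<in> sets \<mu>" by (simp add: sets_eq)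
    have "measure (completion \<mu>) (f -` cball (f x) (1 / real m) \<inter> cball x (1 / real n))
        = measure (completion \<mu>) (Pair x -` E' \<inter> cball x (1 / real n))"
      using 1 S b sec_borel[OF E', of x] by (intro measure_eq_AE) (auto simp: sets_completionI_sets)
    also have "\<dots> = h n x"
      unfolding h_def using sec_borel[OF E', of x] b by (intro measure_completion) auto
    finally show ?thesis .
  qed
  have "x \<in> (\<Union>k. A k)" if x: "x \<in> G" for x
  proof -
    have cp: "mu_continuity_point \<mu> f x" using x N0(1) unfolding G_def by auto
    have "(\<lambda>n. h n x / c n x) \<longlonglongrightarrow> 1"
      using cp[unfolded mu_continuity_point_def, THEN conjunct2, THEN spec, THEN mp, OF m,
          THEN conjunct2, THEN conjunct2]
      unfolding h_eq[OF x] c_def .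
    then have "eventually (\<lambda>n. h n x / c n x > 1 - e) sequentially"
      using e by (intro order_tendstoD) auto
    then obtain k where k: "\<And>n. n \<ge> k \<Longrightarrow> h n x / c n x > 1 - e"
      by (auto simp: eventually_sequentially)
    \<comment> \<open>Index 0 is excluded since continuity points guarantee balls of positive
      measure only for \<open>n \<ge> 1\<close>, and positivity is what allows clearing the
      denominator.\<close>
    have "(1 - e) * c n x \<le> h n x" if n: "n \<ge> max 1 k" for n
    proof -
      have "c n x > 0" using cp n unfolding mu_continuity_point_def c_def by auto
      with k[of n] n show ?thesis by (auto simp: field_simps)
    qed
    then show ?thesis using x by (auto simp: A_def sp intro!: exI[of _ "max 1 k"])
  qed
  then have UA: "(\<Union>k. A k) = G" by (auto simp: A_def)
  have "(\<lambda>k. measure \<mu> (A k)) \<longlonglongrightarrow> measure \<mu> (\<Union>k. A k)"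
    by (intro finite_Lim_measure_incseq) (auto simp: A_def incseq_def A[unfolded A_def])
  then have "(\<lambda>k. measure \<mu> (A k)) \<longlonglongrightarrow> 1" by (simp add: UA mG)
  then have "eventually (\<lambda>k. measure \<mu> (A k) > 1 - e) sequentially"
    using e by (intro order_tendstoD) auto
  then have "eventually (\<lambda>k. measure \<mu> (A k) > 1 - e \<and> k \<ge> 1) sequentially"
    using eventually_ge_at_top by (rule eventually_conj)
  then obtain k where k: "measure \<mu> (A k) > 1 - e" "k \<ge> 1"
    by (auto simp: eventually_sequentially)
  obtain F \<kappa> where F: "finite F" "F \<subseteq> A k" "\<And>x. x \<in> F \<Longrightarrow> \<kappa> x \<ge> k"
    and disj: "disjoint_family_on (\<lambda>x. cball x (1 / real (\<kappa> x))) F"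
    and cov: "measure \<mu> (A k - (\<Union>x\<in>F. cball x (1 / real (\<kappa> x)))) \<le> e"
    using vit A[of k] k(2) e unfolding is_Vitali_def sets_eq by meson
  define B where "B x = cball x (1 / real (\<kappa> x))" for x
  define S where "S x = Pair x -` E' \<inter> B x" for x
  have [measurable]: "B x \<in> sets \<mu>" for x by (simp add: B_def sets_eq)
  have Sm[measurable]: "S x \<in> sets \<mu>" for x unfolding S_def using sec_borel[OF E', of x] by auto
  have disjB: "disjoint_family_on B F" using disj unfolding B_def[abs_def] .
  then have disjS: "disjoint_family_on S F" by (auto simp: S_def disjoint_family_on_def)
  have [measurable]: "(\<Union>x\<in>F. B x) \<in> sets \<mu>" "(\<Union>x\<in>F. S x) \<in> sets \<mu>"
    using F by (auto intro!: sets.finite_UN)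
  have "measure \<mu> (A k) \<le> measure \<mu> ((A k - (\<Union>x\<in>F. B x)) \<union> (\<Union>x\<in>F. B x))"
    by (intro finite_measure_mono) auto
  also have "\<dots> \<le> measure \<mu> (A k - (\<Union>x\<in>F. B x)) + measure \<mu> (\<Union>x\<in>F. B x)"
    by (intro measure_Un_le) auto
  finally have mB: "measure \<mu> (\<Union>x\<in>F. B x) \<ge> 1 - 2 * e"
    using k(1) cov unfolding B_def by linarith
  \<comment> \<open>Disjointness turns both unions into sums, and the density bound applies to each
    term because \<open>x \<in> A k\<close> and \<open>\<kappa> x \<ge> k\<close>.\<close>
  have "(1 - e) * measure \<mu> (\<Union>x\<in>F. B x) = (\<Sum>x\<in>F. (1 - e) * c (\<kappa> x) x)"
    using F disjB by (subst finite_measure_finite_Union) (auto simp: sum_distrib_left c_def B_def sets_eq)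
  also have "\<dots> \<le> (\<Sum>x\<in>F. h (\<kappa> x) x)"
    using F by (intro sum_mono) (auto simp: A_def)
  also have "\<dots> = measure \<mu> (\<Union>x\<in>F. S x)"
    using F disjS by (subst finite_measure_finite_Union) (auto simp: h_def S_def B_def intro: Sm[unfolded S_def B_def])
  finally have mS: "(1 - e) * measure \<mu> (\<Union>x\<in>F. B x) \<le> measure \<mu> (\<Union>x\<in>F. S x)" .
  have "e * measure \<mu> (\<Union>x\<in>F. B x) \<le> e * 1"
    using e prob_le_1 by (intro mult_left_mono) auto
  then have mS: "measure \<mu> (\<Union>x\<in>F. S x) \<ge> 1 - 3 * e"
    using mS mB unfolding left_diff_distrib by linarith
  \<comment> \<open>The sections \<open>S x\<close> are only Borel. One closed set inside their
    union is chosen and afterwards cut along the closed balls \<open>B x\<close>.\<close>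
  obtain K where K: "closed K" "K \<subseteq> (\<Union>x\<in>F. S x)" "measure \<mu> ((\<Union>x\<in>F. S x) - K) \<le> e"
  proof (rule finite_borel_measure_inner_regular_closed[OF finite_measure_axioms sets_eq _ e])
    show "(\<Union>x\<in>F. S x) \<in> sets borel" unfolding sets_eq[symmetric] by measurable
  qed
  have Km: "K \<in> sets \<mu>" using K by (simp add: sets_eq)
  have "measure \<mu> K \<ge> 1 - 4 * e"
    using finite_measure_Diff[of "\<Union>x\<in>F. S x" K] mS K Km by auto
  then have mK: "measure \<mu> (- K) \<le> \<delta>"
    using prob_compl[OF Km] by (simp add: sp Compl_eq_Diff_UNIV e_def)
  have UK: "(\<Union>x\<in>F. K \<inter> B x) = K" using K(2) by (auto simp: S_def)
  show ?thesis
  proof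
    show "finite F" by fact
    show "closed (K \<inter> B x)" for x using K(1) by (auto simp: B_def)
    show "disjoint_family_on (\<lambda>x. K \<inter> B x) F"
      using disjB by (auto simp: disjoint_family_on_def)
    show "measure \<mu> (- (\<Union>x\<in>F. K \<inter> B x)) \<le> \<delta>" using mK UK by simp
    show "dist (f x) (f z) \<le> 1 / real m" if xz: "x \<in> F" "z \<in> K \<inter> B x" for x z
    proof -
      \<comment> \<open>A point of \<open>K\<close> lies in some \<open>S y\<close>, hence in
        \<open>B y\<close>. As the balls are disjoint, \<open>K \<inter> B x\<close> is contained in
        \<open>S x\<close>.\<close>
      obtain y where y: "y \<in> F" "z \<in> S y" using xz K(2) by blast
      then have "y = x" using xz disjB by (auto simp: S_def disjoint_family_on_def)
      with y sec_sub[of x] show ?thesis by (auto simp: S_def)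
    qed
  qed
qed

lemma Vitali_continuous_imp_Lusin:
  fixes \<mu> :: "'a::metric_space measure" and f :: "'a \<Rightarrow> 'b::metric_space"
  assumes cpt: "compact (UNIV :: 'a set)" and prob: "prob_space \<mu>" and sets_eq: "sets \<mu> = sets borel"
    and vit: "is_Vitali \<mu>" and cont: "mu_continuous \<mu> f"
  shows "mu_Lusin \<mu> f"
  unfolding mu_Lusin_def
proof (intro allI impI)
  fix \<epsilon> :: real assume \<epsilon>: "\<epsilon> > 0"
  interpret prob_space \<mu> by fact
  have sp: "space \<mu> = UNIV" using sets_eq_imp_space_eq[OF sets_eq] by simp
  \<comment> \<open>The losses over all scales add up to at most \<open>\<epsilon> / 2\<close>,
    which leaves room for the strict inequality in \<open>mu_Lusin\<close>.\<close>
  have "\<exists>F C. finite F \<and> (\<forall>x\<in>F. closed (C x)) \<and> disjoint_family_on C F \<and>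
    (\<forall>x\<in>F. \<forall>z\<in>C x. dist (f x) (f z) \<le> 1 / real (Suc m)) \<and>
    measure \<mu> (- (\<Union>x\<in>F. C x)) \<le> \<epsilon> / 2 * (1/2) ^ Suc m" for m
  proof -
    have "Suc m \<ge> 1" "\<epsilon> / 2 * (1/2) ^ Suc m > 0" using \<epsilon> by auto
    from Vitali_continuous_pieces[OF cpt prob sets_eq vit cont this] show ?thesis by metis
  qed
  then obtain F C where F: "\<And>m. finite (F m)" and C: "\<And>m x. x \<in> F m \<Longrightarrow> closed (C m x)"
    and disj: "\<And>m. disjoint_family_on (C m) (F m)"
    and osc: "\<And>m x z. x \<in> F m \<Longrightarrow> z \<in> C m x \<Longrightarrow> dist (f x) (f z) \<le> 1 / real (Suc m)"
    and small: "\<And>m. measure \<mu> (- (\<Union>x\<in>F m. C m x)) \<le> \<epsilon> / 2 * (1/2) ^ Suc m"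
    by metis
  define K where "K m = (\<Union>x\<in>F m. C m x)" for m
  have clK: "closed (K m)" for m unfolding K_def using F C by auto
  define M where "M = (\<Inter>m. K m)"
  have clM: "closed M" unfolding M_def using clK by auto
  have [measurable]: "K m \<in> sets \<mu>" "- K m \<in> sets \<mu>" "M \<in> sets \<mu>" for m
    using clK clM by (auto simp: sets_eq)
  have sm: "(\<lambda>i. \<epsilon> / 2 * (1/2) ^ Suc i) sums (\<epsilon> / 2 * 1)"
    by (intro sums_mult power_half_series)
  have sm2: "summable (\<lambda>i. measure \<mu> (- K i))"
    using small by (intro summable_comparison_test'[OF sums_summable[OF sm]]) (auto simp: K_def)
  have "measure \<mu> (- M) = measure \<mu> (\<Union>m. - K m)" by (simp add: M_def)
  also have "\<dots> \<le> (\<Sum>i. measure \<mu> (- K i))"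
    using sm2 by (intro finite_measure_subadditive_countably) auto
  also have "\<dots> \<le> (\<Sum>i. \<epsilon> / 2 * (1/2) ^ Suc i)"
    using small sm2 sums_summable[OF sm] unfolding K_def by (intro suminf_le) auto
  also have "\<dots> = \<epsilon> / 2" using sums_unique[OF sm] by simp
  finally have "measure \<mu> M > 1 - \<epsilon>"
    using prob_compl[of M] \<epsilon> by (simp add: sp Compl_eq_Diff_UNIV)
  moreover have "compact M" using compact_Int_closed[OF cpt clM] by simp
  moreover have "continuous_on M f"
    unfolding continuous_on_iff
  proof (intro ballI allI impI)
    fix a and e :: real assume a: "a \<in> M" and "e > 0"
    then obtain m where m: "inverse (Suc m) < e / 2" using reals_Archimedean[of "e / 2"] by auto
    obtain x where x: "x \<in> F m" "a \<in> C m x" using a by (auto simp: M_def K_def)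
    \<comment> \<open>The other pieces form a closed set missing \<open>a\<close>, so near
      \<open>a\<close> the set \<open>M\<close> meets only the piece \<open>C m x\<close>. There
      \<open>f z\<close> and \<open>f a\<close> are both within \<open>1 / Suc m\<close> of
      \<open>f x\<close>, whence the choice of \<open>e / 2\<close>.\<close>
    define W where "W = (\<Union>y\<in>F m - {x}. C m y)"
    have "closed W" unfolding W_def using F C by (intro closed_UN) auto
    moreover have "a \<notin> W"
      using x disj[of m] by (auto simp: W_def disjoint_family_on_def)
    ultimately obtain d where d: "d > 0" "ball a d \<subseteq> - W"
      using open_contains_ball[of "- W"] by (auto simp: open_Compl)
    have "dist (f z) (f a) < e" if z: "z \<in> M" "dist z a < d" for z
    proof -
      obtain y where y: "y \<in> F m" "z \<in> C m y" using z by (auto simp: M_def K_def)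
      have "z \<notin> W" using d z by (auto simp: dist_commute)
      with y have "z \<in> C m x" by (auto simp: W_def)
      then have "dist (f x) (f z) \<le> inverse (Suc m)" "dist (f x) (f a) \<le> inverse (Suc m)"
        using osc x by (auto simp: inverse_eq_divide)
      then show ?thesis using m dist_triangle3[of "f z" "f a" "f x"] by linarith
    qed
    with d show "\<exists>d>0. \<forall>z\<in>M. dist z a < d \<longrightarrow> dist (f z) (f a) < e" by blast
  qed
  ultimately show "\<exists>M. compact M \<and> 1 - \<epsilon> < measure \<mu> M \<and> continuous_on M f" by blast
qed

section \<open>From Lusin to mu-continuity under the density theorem\<close>

lemma density_Lusin_imp_continuous:
  fixes \<mu> :: "'a::metric_space measure" and f :: "'a \<Rightarrow> 'b::metric_space"
  assumes cpt: "compact (UNIV :: 'a set)" and prob: "prob_space \<mu>" and sets_eq: "sets \<mu> = sets borel"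
    and dens: "satisfies_Lebesgue_density \<mu>" and lus: "mu_Lusin \<mu> f"
  shows "mu_continuous \<mu> f"
proof -
  interpret prob_space \<mu> by fact
  interpret P: pair_prob_space \<mu> \<mu> by unfold_locales
  interpret C: finite_measure "completion \<mu>" by (rule finite_measureI) simp
  have sp: "space \<mu> = UNIV" using sets_eq_imp_space_eq[OF sets_eq] by simp
  have sp2: "space (\<mu> \<Otimes>\<^sub>M \<mu>) = UNIV" by (simp add: space_pair_measure sp)
  have sets2: "sets (\<mu> \<Otimes>\<^sub>M \<mu>) = sets (borel \<Otimes>\<^sub>M borel)"
    using sets_eq sets_eq by (rule sets_pair_measure_cong)
  \<comment> \<open>The part of \<open>S\<close> outside \<open>Z\<close> sits in a null set, which
    the completion absorbs. The measure is arbitrary so that both \<open>\<mu>\<close> and its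
    square are served.\<close>
  have completeI: "S \<in> sets (completion M)"
    if "S \<inter> Z \<in> sets M" "- Z \<in> null_sets M" for S Z and M :: "'c measure"
  proof -
    have "S - Z \<in> null_sets (completion M)"
      using that(2) by (intro null_sets_completion_subset[of "S - Z" "- Z"] null_sets_completionI) auto
    then have "(S \<inter> Z) \<union> (S - Z) \<in> sets (completion M)"
      using that(1) by (intro sets.Un) (auto intro: sets_completionI_sets)
    then show ?thesis by (simp add: Int_Diff_Un)
  qed
  \<comment> \<open>Countably many tolerances suffice: the union \<open>Z\<close> of the
    \<open>M k\<close> has measure 1, so almost every point lies in a compact set on which
    \<open>f\<close> is continuous.\<close>
  have "\<exists>M. compact M \<and> measure \<mu> M > 1 - inverse (Suc k) \<and> continuous_on M f" for k
    using lus unfolding mu_Lusin_def by simp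
  then obtain M where M: "\<And>k. compact (M k)" "\<And>k. measure \<mu> (M k) > 1 - inverse (Suc k)"
    "\<And>k. continuous_on (M k) f" by metis
  have clM: "closed (M k)" for k using M(1) by (rule compact_imp_closed)
  have [measurable]: "M k \<in> sets \<mu>" for k using clM by (simp add: sets_eq)
  define Z where "Z = (\<Union>k. M k)"
  have Z[measurable]: "Z \<in> sets \<mu>" unfolding Z_def by measurable
  have "measure \<mu> Z = 1"
  proof (rule ccontr)
    assume "measure \<mu> Z \<noteq> 1"
    then have "1 - measure \<mu> Z > 0" using prob_le_1[of Z] by linarith
    then obtain k where "inverse (Suc k) < 1 - measure \<mu> Z" using reals_Archimedean by blast
    moreover have "measure \<mu> (M k) \<le> measure \<mu> Z"
      by (intro finite_measure_mono) (auto simp: Z_def)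
    ultimately show False using M(2)[of k] by linarith
  qed
  then have eZ: "emeasure \<mu> Z = 1" by (simp add: emeasure_eq_measure)
  have nullZ: "- Z \<in> null_sets \<mu>"
    using \<open>measure \<mu> Z = 1\<close> prob_compl[OF Z]
    by (auto simp: sp Compl_eq_Diff_UNIV null_sets_def emeasure_eq_measure sets.compl_sets[OF Z, unfolded sp])
  have aeZ: "AE x in \<mu>. x \<in> Z" using AE_not_in[OF nullZ] by simp
  have ZZ: "Z \<times> Z \<in> sets (\<mu> \<Otimes>\<^sub>M \<mu>)" by measurable
  have "emeasure (\<mu> \<Otimes>\<^sub>M \<mu>) (Z \<times> Z) = 1" by (simp add: emeasure_pair_measure_Times eZ)
  then have "P.prob (Z \<times> Z) = 1" by (simp add: measure_def)
  then have nullZZ: "- (Z \<times> Z) \<in> null_sets (\<mu> \<Otimes>\<^sub>M \<mu>)"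
    using P.prob_compl[OF ZZ] sets.compl_sets[OF ZZ]
    by (auto simp: sp2 Compl_eq_Diff_UNIV null_sets_def P.emeasure_eq_measure)
  have prod_meas: "(\<lambda>(x', z). indicator (f -` cball (f x') r) z :: real)
        \<in> borel_measurable (completion (\<mu> \<Otimes>\<^sub>M \<mu>))" for r
  proof -
    define E where "E = {p. dist (f (fst p)) (f (snd p)) \<le> r}"
    \<comment> \<open>Two indices, since the two coordinates may lie in different members of the
      family. On each product \<open>M j \<times> M k\<close> the distance of the values is
      continuous, so \<open>E\<close> is relatively closed there.\<close>
    have "closed (E \<inter> M j \<times> M k)" for j k
    proof -
      have "continuous_on (M j \<times> M k) (\<lambda>p. dist (f (fst p)) (f (snd p)))"
        by (intro continuous_intros continuous_on_compose2[OF M(3)]) auto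
      then have "closed (M j \<times> M k \<inter> (\<lambda>p. dist (f (fst p)) (f (snd p))) -` {..r})"
        by (rule continuous_closed_preimage) (auto intro: closed_Times clM)
      then show ?thesis by (simp add: E_def vimage_def Int_commute)
    qed
    then have "E \<inter> M j \<times> M k \<in> sets (\<mu> \<Otimes>\<^sub>M \<mu>)" for j k
      unfolding sets2 by (intro closed_in_sets_borel_pair cpt)
    then have "(\<Union>j. \<Union>k. E \<inter> M j \<times> M k) \<in> sets (\<mu> \<Otimes>\<^sub>M \<mu>)"
      by (intro sets.countable_UN'') auto
    also have "(\<Union>j. \<Union>k. E \<inter> M j \<times> M k) = E \<inter> Z \<times> Z" by (auto simp: Z_def)
    finally have "E \<in> sets (completion (\<mu> \<Otimes>\<^sub>M \<mu>))" using nullZZ by (rule completeI)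
    then have "(indicator E :: _ \<Rightarrow> real) \<in> borel_measurable (completion (\<mu> \<Otimes>\<^sub>M \<mu>))"
      by (rule borel_measurable_indicator)
    also have "(indicator E :: _ \<Rightarrow> real) = (\<lambda>(x', z). indicator (f -` cball (f x') r) z)"
      by (auto simp: E_def indicator_def fun_eq_iff)
    finally show ?thesis .
  qed
  have sec_meas: "f -` cball y r \<in> sets (completion \<mu>)" for y r
  proof (rule completeI[OF _ nullZ])
    have "closed (M k \<inter> f -` cball y r)" for k
      using M(3) clM by (rule continuous_closed_preimage) simp
    then have "(\<Union>k. M k \<inter> f -` cball y r) \<in> sets \<mu>"
      unfolding sets_eq by (intro sets.countable_UN'') auto
    also have "(\<Union>k. M k \<inter> f -` cball y r) = f -` cball y r \<inter> Z" by (auto simp: Z_def)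
    finally show "f -` cball y r \<inter> Z \<in> sets \<mu>" .
  qed
  \<comment> \<open>The family is countable, so the exceptional null sets of all the
    \<open>M k\<close> can be discarded together.\<close>
  have "AE x in \<mu>. x \<in> M k \<longrightarrow>
      (\<lambda>n. measure \<mu> (M k \<inter> cball x (1 / real n)) / measure \<mu> (cball x (1 / real n))) \<longlonglongrightarrow> 1" for k
    using dens clM[of k] unfolding satisfies_Lebesgue_density_def by simp
  then have "AE x in \<mu>. \<forall>k. x \<in> M k \<longrightarrow>
      (\<lambda>n. measure \<mu> (M k \<inter> cball x (1 / real n)) / measure \<mu> (cball x (1 / real n))) \<longlonglongrightarrow> 1"
    by (simp add: AE_all_countable)
  with aeZ have "AE x in \<mu>. mu_continuity_point \<mu> f x"
  proof eventually_elim
    case (elim x)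
    then obtain k where k: "x \<in> M k" by (auto simp: Z_def)
    define c where "c n = measure \<mu> (cball x (1 / real n))" for n
    have lim: "(\<lambda>n. measure \<mu> (M k \<inter> cball x (1 / real n)) / c n) \<longlonglongrightarrow> 1"
      using elim(2) k unfolding c_def by blast
    \<comment> \<open>A zero denominator would make the quotient 0, so the limit 1 forces
      \<open>c i > 0\<close> for large \<open>i\<close>, and larger balls inherit this. Index 0 is
      left out because \<open>1 / real 0 = 0\<close> gives a single point.\<close>
    have pos: "c n > 0" if n: "n \<ge> 1" for n
    proof -
      have "eventually (\<lambda>n. measure \<mu> (M k \<inter> cball x (1 / real n)) / c n > 0) sequentially"
        using lim by (rule order_tendstoD) simp
      then obtain q where q: "\<And>i. i \<ge> q \<Longrightarrow> measure \<mu> (M k \<inter> cball x (1 / real i)) / c i > 0"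
        by (auto simp: eventually_sequentially)
      define i where "i = max n q"
      have "c i \<noteq> 0" using q[of i] unfolding i_def by fastforce
      then have "c i > 0" by (simp add: c_def zero_less_measure_iff)
      also have "c i \<le> c n"
        unfolding c_def using n by (intro finite_measure_mono subset_cball frac_le) (auto simp: i_def sets_eq)
      finally show ?thesis .
    qed
    have lim': "(\<lambda>n. measure (completion \<mu>) (f -` cball (f x) (1 / real m) \<inter> cball x (1 / real n)) / c n) \<longlonglongrightarrow> 1"
      if m: "m \<ge> 1" for m
    \<comment> \<open>The quotient is squeezed between the density quotient of \<open>M k\<close>
      and 1: by continuity on \<open>M k\<close>, the part of \<open>M k\<close> in the ball lies in
      the preimage as soon as \<open>1 / real n < d\<close>.\<close>
    proof (rule tendsto_sandwich[OF _ _ lim tendsto_const])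
      have b: "cball x (1 / real n) \<in> sets (completion \<mu>)" for n
        by (intro sets_completionI_sets) (simp add: sets_eq)
      have mc: "measure (completion \<mu>) (cball x (1 / real n)) = c n" for n
        unfolding c_def by (intro measure_completion) (simp add: sets_eq)
      have "measure (completion \<mu>) (f -` cball (f x) (1 / real m) \<inter> cball x (1 / real n)) / c n \<le> 1" for n
      proof -
        have "measure (completion \<mu>) (f -` cball (f x) (1 / real m) \<inter> cball x (1 / real n)) \<le> c n"
          unfolding mc[symmetric] by (intro C.finite_measure_mono b) auto
        moreover have "c n \<ge> 0" by (simp add: c_def)
        ultimately show ?thesis by (cases "c n = 0") (auto simp: divide_simps)
      qed
      then show "\<forall>\<^sub>F n in sequentially.
        measure (completion \<mu>) (f -` cball (f x) (1 / real m) \<inter> cball x (1 / real n)) / c n \<le> 1" by simp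
      have "1 / real m > 0" using m by simp
      then obtain d where d: "d > 0" "\<And>z. z \<in> M k \<Longrightarrow> dist z x < d \<Longrightarrow> dist (f z) (f x) < 1 / real m"
        using M(3)[of k] k unfolding continuous_on_iff by meson
      have "eventually (\<lambda>n. 1 / real n < d) sequentially"
        using lim_1_over_n d(1) by (rule order_tendstoD)
      then show "\<forall>\<^sub>F n in sequentially. measure \<mu> (M k \<inter> cball x (1 / real n)) / c n \<le>
        measure (completion \<mu>) (f -` cball (f x) (1 / real m) \<inter> cball x (1 / real n)) / c n"
      proof eventually_elim
        case (elim n)
        have "measure \<mu> (M k \<inter> cball x (1 / real n)) = measure (completion \<mu>) (M k \<inter> cball x (1 / real n))"
          by (intro measure_completion[symmetric]) (simp add: sets_eq clM)
        also have "\<dots> \<le> measure (completion \<mu>) (f -` cball (f x) (1 / real m) \<inter> cball x (1 / real n))"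
          using d(2) elim by (intro C.finite_measure_mono sets.Int b sec_meas) (force simp: dist_commute)
        finally show ?case by (intro divide_right_mono) (auto simp: c_def)
      qed
    qed
    show ?case
      unfolding mu_continuity_point_def
      using pos lim' prod_meas sec_meas unfolding c_def by blast
  qed
  then show ?thesis by (simp add: mu_continuous_def)
qed

theorem theorem16:
  fixes \<mu> :: "'a::metric_space measure"
    and f :: "'a \<Rightarrow> 'b::metric_space"
  assumes "compact (UNIV :: 'a set)"
    and "prob_space \<mu>"
    and "sets \<mu> = sets borel"
  shows "(is_Vitali \<mu> \<longrightarrow> mu_continuous \<mu> f \<longrightarrow> mu_Lusin \<mu> f) \<and>
         (satisfies_Lebesgue_density \<mu> \<longrightarrow> mu_Lusin \<mu> f \<longrightarrow> mu_continuous \<mu> f)"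
  using Vitali_continuous_imp_Lusin[OF assms] density_Lusin_imp_continuous[OF assms] by blast

end
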